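(* Let $P$ be the poset defined in the context. The map \[ \Phi:\mathbb R_{\mathrm{cc}}\longrightarrow\operatorname{Max}(P),\qquad \Phi(p)=m_p=(\{p\},E_{\{p\}}), \] is a homeomorphism, where $\operatorname{Max}(P)$ carries the subspace topology inherited from the Scott topology on $P$. Consequently $P$, together with the identification $p\leftrightarrow m_p$, is a bounded complete dcpo model of $\mathbb R_{\mathrm{cc}}$ (that is, $P$ is a bounded complete dcpo and $\operatorname{Max}(P)$ with the subspace Scott topology is homeomorphic to $\mathbb R_{\mathrm{cc}}$ via $\Phi$).
   Context: Countable means of cardinality at most $\aleph_0$ (finite sets included). For a set $M$, $[M]^\omega$ is the set of countably infinite subsets of $M$, $[M]^{\le\omega}$ the set of all countable subsets of $M$ (including finite sets and $\varnothing$), and $[M]^{<\omega}$ the set of finite subsets of $M$. $\mathbb R_{\mathrm{cc}}$ is $\mathbb R$ with the cocountable topology $\tau_{\mathrm{cc}}=\{\varnothing\}\cup\{U\subseteq\mathbb R:\mathbb R\setminus U\text{ is countable}\}$. The detector family. Fix a family $\mathcal A\subseteq[\mathbb R]^\omega$ of cardinality $\mathfrak c=|\mathbb R|$ that is almost disjoint ($A\cap B$ is finite for distinct $A,B\in\mathcal A$) and such that every uncountable $B\subseteq\mathbb R$ contains some $A\in\mathcal A$ as a subset (such a family exists in ZFC by a theorem of Komjáth). Let $2^{<\omega}$ be the set of finite binary sequences and $2^\omega$ the set of functions $\omega\to\{0,1\}$; for $\xi\in2^\omega$ let $\xi\upharpoonright n$ be its restriction to the first $n$ coordinates. For each $A\in\mathcal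 A$ fix an injection $e_A:2^{<\omega}\to A$, and for $\xi\in2^\omega$ put $A^\xi=\{e_A(\xi\upharpoonright n):n<\omega\}$. Fix a bijection $\beta:\mathbb R\to2^\omega$ and, for $p\in\mathbb R$, put $\mathcal S_p=\{A^{\beta(p)}\setminus\{p\}:A\in\mathcal A\}$. The topology $\tau$. For $p\in\mathbb R$, $S\in\mathcal S_p$ and finite $F\subseteq S$, let $K(p,S,F)=\{p\}\cup(S\setminus F)$. Let $\mathscr K=\{\mathbb R\}\cup\{\{x\}:x\in\mathbb R\}\cup\{K(p,S,F):p\in\mathbb R,\ S\in\mathcal S_p,\ F\in[S]^{<\omega}\}$, and let $\tau$ be the topology on $\mathbb R$ having $\{\mathbb R\setminus K:K\in\mathscr K\}$ as a subbase of open sets. The poset $P$. Let $\mathcal C$ be the set of nonempty $\tau$-closed subsets of $\mathbb R$. For $C\in\mathcal C$ let $E_C=[\mathbb R\setminus C]^{\le\omega}$ (singletons are $\tau$-closed, so $E_{\{p\}}$ is defined). Let $P=\{(C,\Lambda):C\in\mathcal C,\ \Lambda\subseteq E_C\}$, ordered by $(C,\Lambda)\le(D,\Gamma)$ iff $D\subseteq C$ and $\Lambda\subseteq\Gamma$. $\operatorname{Max}(P)$ is the set of maximal elements of $P$. Order notions. A nonempty subset $D$ of a poset is directed if any two elements of $D$ have an upper bound in $D$. A dcpo is a poset in which every directed subset has a supremum; a poset is bounded complete if every nonempty upper-bounded subset has a supremum. The Scott topology on a poset consists of the upper sets $U$ such that whenever $D$ is directed, has a supremum, and $\bigvee D\in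 U$, then $D\cap U\ne\varnothing$. *)

theory Defs
  imports "HOL-Analysis.Analysis" "HOL-Library.Equipollence" "HOL-Algebra.Order"
begin

text \<open>
  Posets are HOL-Algebra's \<^locale>\<open>partial_order\<close> structures with an explicit carrier;
  "\<open>s\<close> is the supremum of \<open>D\<close>" is \<open>is_lub L s D\<close>.
\<close>

definition directed_in :: "('a, 'b) gorder_scheme \<Rightarrow> 'a set \<Rightarrow> bool" where
  "directed_in L D \<longleftrightarrow>
     D \<subseteq> carrier L \<and> D \<noteq> {} \<and> (\<forall>x\<in>D. \<forall>y\<in>D. \<exists>z\<in>D. x \<sqsubseteq>\<^bsub>L\<^esub> z \<and> y \<sqsubseteq>\<^bsub>L\<^esub> z)"

definition dcpo :: "('a, 'b) gorder_scheme \<Rightarrow> bool" where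
  "dcpo L \<longleftrightarrow> partial_order L \<and> (\<forall>D. directed_in L D \<longrightarrow> (\<exists>s. is_lub L s D))"

definition bounded_complete :: "('a, 'b) gorder_scheme \<Rightarrow> bool" where
  "bounded_complete L \<longleftrightarrow> partial_order L \<and>
     (\<forall>A. A \<subseteq> carrier L \<and> A \<noteq> {} \<and> Upper L A \<noteq> {} \<longrightarrow> (\<exists>s. is_lub L s A))"

definition maximal_elements :: "('a, 'b) gorder_scheme \<Rightarrow> 'a set" where
  "maximal_elements L = {x \<in> carrier L. \<forall>y\<in>carrier L. x \<sqsubseteq>\<^bsub>L\<^esub> y \<longrightarrow> y = x}"

definition scott_open :: "('a, 'b) gorder_scheme \<Rightarrow> 'a set \<Rightarrow> bool" where
  "scott_open L U \<longleftrightarrow>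
     U \<subseteq> carrier L \<and>
     (\<forall>x\<in>U. \<forall>y\<in>carrier L. x \<sqsubseteq>\<^bsub>L\<^esub> y \<longrightarrow> y \<in> U) \<and>
     (\<forall>D s. directed_in L D \<and> is_lub L s D \<and> s \<in> U \<longrightarrow> D \<inter> U \<noteq> {})"

definition scott_topology :: "('a, 'b) gorder_scheme \<Rightarrow> 'a topology" where
  "scott_topology L = topology (scott_open L)"

lemma istopology_scott_open: "istopology (scott_open L)"
  unfolding istopology_def
proof (intro conjI allI impI)
  fix S T assume S: "scott_open L S" and T: "scott_open L T"
  show "scott_open L (S \<inter> T)"
    unfolding scott_open_def
  proof (intro conjI allI impI)
    show "S \<inter> T \<subseteq> carrier L" using S by (auto simp: scott_open_def)
    show "\<forall>x\<in>S \<inter> T. \<forall>y\<in>carrier L. x \<sqsubseteq>\<^bsub>L\<^esub> y \<longrightarrow> y \<in> S \<inter> T"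
      using S T by (auto simp: scott_open_def)
    fix D s assume *: "directed_in L D \<and> is_lub L s D \<and> s \<in> S \<inter> T"
    obtain a where a: "a \<in> D" "a \<in> S" using S * unfolding scott_open_def by blast
    obtain b where b: "b \<in> D" "b \<in> T" using T * unfolding scott_open_def by blast
    obtain c where c: "c \<in> D" "c \<in> carrier L" "a \<sqsubseteq>\<^bsub>L\<^esub> c" "b \<sqsubseteq>\<^bsub>L\<^esub> c"
      using * a b unfolding directed_in_def by blast
    have "c \<in> S" "c \<in> T" using S T a b c unfolding scott_open_def by blast+
    then show "D \<inter> (S \<inter> T) \<noteq> {}" using c by blast
  qed
next
  fix \<K> assume *: "\<forall>K\<in>\<K>. scott_open L K"
  show "scott_open L (\<Union>\<K>)"
    unfolding scott_open_def
  proof (intro conjI allI impI)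
    show "\<Union>\<K> \<subseteq> carrier L" using * by (auto simp: scott_open_def)
    show "\<forall>x\<in>\<Union>\<K>. \<forall>y\<in>carrier L. x \<sqsubseteq>\<^bsub>L\<^esub> y \<longrightarrow> y \<in> \<Union>\<K>"
      using * unfolding scott_open_def by (meson UnionE UnionI)
    fix D s assume D: "directed_in L D \<and> is_lub L s D \<and> s \<in> \<Union>\<K>"
    then obtain K where K: "K \<in> \<K>" "s \<in> K" by blast
    then have "scott_open L K" using * by simp
    then have "D \<inter> K \<noteq> {}" using D K(2) unfolding scott_open_def by blast
    then show "D \<inter> \<Union>\<K> \<noteq> {}" using K(1) by blast
  qed
qed

lemma openin_scott_topology: "openin (scott_topology L) U \<longleftrightarrow> scott_open L U"
  by (simp add: scott_topology_def istopology_scott_open)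

definition cocountable_topology :: "real topology" where
  "cocountable_topology = topology (\<lambda>U. U = {} \<or> countable (- U))"

lemma istopology_cocountable: "istopology (\<lambda>U::real set. U = {} \<or> countable (- U))"
  unfolding istopology_def
proof (intro conjI allI impI)
  fix S T :: "real set" assume "S = {} \<or> countable (- S)" "T = {} \<or> countable (- T)"
  then show "S \<inter> T = {} \<or> countable (- (S \<inter> T))" by (auto simp: Compl_Int)
next
  fix \<K> :: "real set set" assume *: "\<forall>K\<in>\<K>. K = {} \<or> countable (- K)"
  show "\<Union>\<K> = {} \<or> countable (- \<Union>\<K>)"
  proof (cases "\<Union>\<K> = {}")
    case False
    then obtain K where "K \<in> \<K>" "K \<noteq> {}" by blast
    then have "countable (- K)" "- \<Union>\<K> \<subseteq> - K" using * by auto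
    then show ?thesis by (intro disjI2) (rule countable_subset)
  qed auto
qed

lemma openin_cocountable_topology:
  "openin cocountable_topology U \<longleftrightarrow> U = {} \<or> countable (- U)"
  by (simp add: cocountable_topology_def istopology_cocountable)

definition detector_family :: "real set set \<Rightarrow> bool" where
  "detector_family \<A> \<longleftrightarrow>
     (\<forall>A\<in>\<A>. countable A \<and> infinite A) \<and>
     \<A> \<approx> (UNIV :: real set) \<and>
     (\<forall>A\<in>\<A>. \<forall>B\<in>\<A>. A \<noteq> B \<longrightarrow> finite (A \<inter> B)) \<and>
     (\<forall>B. uncountable B \<longrightarrow> (\<exists>A\<in>\<A>. A \<subseteq> B))"

text \<open>
  Finite binary sequences are \<^typ>\<open>bool list\<close>s and infinite ones are functions
  \<^typ>\<open>nat \<Rightarrow> bool\<close>. The parameter \<open>e\<close> below assigns to each \<open>A \<in> \<A>\<close> the injection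
  \<open>e A\<close> from finite binary sequences into \<open>A\<close>.
\<close>

definition seq_restrict :: "(nat \<Rightarrow> bool) \<Rightarrow> nat \<Rightarrow> bool list" where
  "seq_restrict \<xi> n = map \<xi> [0..<n]"

definition branch_set :: "(real set \<Rightarrow> bool list \<Rightarrow> real) \<Rightarrow> real set \<Rightarrow> (nat \<Rightarrow> bool) \<Rightarrow> real set" where
  "branch_set e A \<xi> = {e A (seq_restrict \<xi> n) | n. True}"

definition traces ::
  "real set set \<Rightarrow> (real set \<Rightarrow> bool list \<Rightarrow> real) \<Rightarrow> (real \<Rightarrow> nat \<Rightarrow> bool) \<Rightarrow> real \<Rightarrow> real set set" where
  "traces \<A> e \<beta> p = {branch_set e A (\<beta> p) - {p} | A. A \<in> \<A>}"

definition K_set :: "real \<Rightarrow> real set \<Rightarrow> real set \<Rightarrow> real set" where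
  "K_set p S F = {p} \<union> (S - F)"

definition closed_subbase ::
  "real set set \<Rightarrow> (real set \<Rightarrow> bool list \<Rightarrow> real) \<Rightarrow> (real \<Rightarrow> nat \<Rightarrow> bool) \<Rightarrow> real set set" where
  "closed_subbase \<A> e \<beta> =
     {UNIV} \<union> {{x} | x. True} \<union>
     {K_set p S F | p S F. S \<in> traces \<A> e \<beta> p \<and> F \<subseteq> S \<and> finite F}"

definition tau ::
  "real set set \<Rightarrow> (real set \<Rightarrow> bool list \<Rightarrow> real) \<Rightarrow> (real \<Rightarrow> nat \<Rightarrow> bool) \<Rightarrow> real topology" where
  "tau \<A> e \<beta> = topology_generated_by {UNIV - K | K. K \<in> closed_subbase \<A> e \<beta>}"

text \<open>
  \<^const>\<open>topology_generated_by\<close> makes the union of the subbase the underlying space;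
  here that is all of the reals.
\<close>

lemma topspace_tau: "topspace (tau \<A> e \<beta>) = UNIV"
proof -
  have "{x} \<in> closed_subbase \<A> e \<beta>" for x :: real
    by (simp add: closed_subbase_def)
  then have "UNIV - {x} \<in> {UNIV - K | K. K \<in> closed_subbase \<A> e \<beta>}" for x :: real
    by (intro CollectI exI[of _ "{x}"]) simp
  then have "y \<in> \<Union>{UNIV - K | K. K \<in> closed_subbase \<A> e \<beta>}" for y :: real
    by (rule UnionI[of "UNIV - {y + 1}"]) simp
  then have "\<Union>{UNIV - K | K. K \<in> closed_subbase \<A> e \<beta>} = UNIV"
    by (simp only: set_eq_iff UNIV_I simp_thms)
  then show ?thesis
    by (simp only: tau_def topology_generated_by_topspace)
qed

definition E_set :: "real set \<Rightarrow> real set set" where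
  "E_set C = {Q. Q \<subseteq> UNIV - C \<and> countable Q}"

definition P_poset ::
  "real set set \<Rightarrow> (real set \<Rightarrow> bool list \<Rightarrow> real) \<Rightarrow> (real \<Rightarrow> nat \<Rightarrow> bool) \<Rightarrow>
   (real set \<times> real set set) gorder" where
  "P_poset \<A> e \<beta> =
     \<lparr>carrier = {(C, \<Lambda>). closedin (tau \<A> e \<beta>) C \<and> C \<noteq> {} \<and> \<Lambda> \<subseteq> E_set C},
      eq = (=),
      le = (\<lambda>(C, \<Lambda>) (D, \<Gamma>). D \<subseteq> C \<and> \<Lambda> \<subseteq> \<Gamma>)\<rparr>"

definition Phi :: "real \<Rightarrow> real set \<times> real set set" where
  "Phi p = ({p}, E_set {p})"

end

theory Submission
  imports Defs
begin

text \<open>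
  Two distinct branches of one \<open>A \<in> \<A>\<close>, or branches of distinct members of \<open>\<A>\<close>, meet in a
  finite set, so two sets \<open>K(p,S,F)\<close> and \<open>K(q,T,G)\<close> with \<open>p \<noteq> q\<close> have finite intersection.
  By Alexander's subbase theorem \<open>\<tau>\<close> is therefore compact, and suprema in \<open>P\<close> are computed as
  \<open>(\<Inter>C\<^sub>i, \<Union>\<Lambda>\<^sub>i)\<close>. A cocountable set with complement \<open>Q\<close> is the trace on the maximal
  points of the Scott open set \<open>{(C, \<Lambda>). Q \<in> \<Lambda>}\<close>. Conversely, let \<open>m\<^sub>p\<close> lie in a Scott open set
  \<open>U\<close>. As \<open>m\<^sub>p\<close> is the directed supremum of the \<open>({p}, \<Lambda>)\<close> with \<open>\<Lambda>\<close> finite, some such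
  \<open>({p}, \<Lambda>)\<close> is in \<open>U\<close>. If the points \<open>q\<close> with \<open>m\<^sub>q \<notin> U\<close> were uncountable in number, some
  \<open>A \<in> \<A>\<close> would consist of such points and avoid the countable set \<open>\<Union>\<Lambda>\<close>. With \<open>S\<close> the trace of
  \<open>A\<close> at \<open>p\<close>, the directed supremum of the \<open>(K(p,S,F), \<Lambda>)\<close> is \<open>({p}, \<Lambda>)\<close>, so one of them is in
  \<open>U\<close>, and then so is \<open>m\<^sub>q\<close> for every \<open>q \<in> S - F\<close>, a contradiction.
\<close>

section \<open>Compactness of \<open>\<tau>\<close>\<close>

text \<open>By Alexander's theorem only subbasic covers matter. The complements of a cover have
  empty intersection, so by \<open>linked\<close> two of them meet in a finite set. The
  corresponding two members miss only finitely many points, and each of these costs one more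
  member.\<close>

lemma compact_space_generated_by_complements:
  fixes \<K> :: "'a set set"
  assumes cover: "\<Inter>\<K> = {}"
    and linked: "\<And>\<G>. \<G> \<subseteq> \<K> \<Longrightarrow> (\<And>K L. K \<in> \<G> \<Longrightarrow> L \<in> \<G> \<Longrightarrow> infinite (K \<inter> L)) \<Longrightarrow> \<Inter>\<G> \<noteq> {}"
  shows "compact_space (topology_generated_by {UNIV - K | K. K \<in> \<K>})"
proof -
  define \<B> where "\<B> = {UNIV - K | K. K \<in> \<K>}"
  \<comment> \<open>The form of topology that \<open>Alexander_subbase\<close> handles. Compactness
    passes to the generated topology because all its open sets turn out to be open in
    \<open>X\<close>.\<close>
  define X where
    "X = topology (arbitrary union_of (finite intersection_of (\<lambda>U. U \<in> \<B>) relative_to \<Union>\<B>))"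
  have U\<B>: "\<Union>\<B> = UNIV"
    using cover unfolding \<B>_def by blast
  then have tX: "topspace X = UNIV"
    by (simp add: X_def)
  have "compact_space X"
  proof (rule Alexander_subbase)
    show "topology (arbitrary union_of (finite intersection_of (\<lambda>U. U \<in> \<B>) relative_to \<Union>\<B>)) = X"
      by (simp add: X_def)
    fix C assume C: "C \<subseteq> \<B>" "\<Union>C = topspace X"
    define \<G> where "\<G> = uminus ` C"
    have "\<G> \<subseteq> \<K>"
      using C(1) by (auto simp: \<G>_def \<B>_def Compl_eq_Diff_UNIV[symmetric])
    moreover have "\<Inter>\<G> = {}"
      using C(2) by (auto simp: \<G>_def tX)
    ultimately obtain V W where VW: "V \<in> C" "W \<in> C" "finite (- V \<inter> - W)"
      using linked[of \<G>] by (auto simp: \<G>_def)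
    have "\<forall>x. \<exists>U\<in>C. x \<in> U"
      using C(2) tX by auto
    then obtain u where u: "\<And>x. u x \<in> C \<and> x \<in> u x"
      by metis
    have "\<Union>({V, W} \<union> u ` (- V \<inter> - W)) = topspace X"
    proof -
      have "x \<in> \<Union>({V, W} \<union> u ` (- V \<inter> - W))" for x
        using u[of x] by (cases "x \<in> V \<or> x \<in> W") auto
      then show ?thesis
        unfolding tX by blast
    qed
    then show "\<exists>C'. finite C' \<and> C' \<subseteq> C \<and> \<Union>C' = topspace X"
      using VW u by (intro exI[of _ "{V, W} \<union> u ` (- V \<inter> - W)"]) auto
  qed
  moreover have "openin X U" if "openin (topology_generated_by \<B>) U" for U
  proof -
    have "generate_topology_on \<B> U"
      using that by (rule openin_topology_generated_by)
    then show ?thesis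
    proof (rule generate_topology_on_coarsest[OF istopology_openin, rotated])
      fix s assume "s \<in> \<B>"
      then show "openin X s"
        unfolding X_def openin_subbase U\<B>
        by (metis UNIV_I arbitrary_union_of_inc finite_intersection_of_inc inf_top_left relative_to_def)
    qed
  qed
  ultimately show ?thesis
    unfolding \<B>_def[symmetric] compact_space_alt
    by (simp add: tX U\<B>)
qed

section \<open>Almost disjointness of branches and traces\<close>

lemma inj_seq_restrict: "inj (seq_restrict \<xi>)"
  by (rule injI) (metis diff_zero length_map length_upt seq_restrict_def)

lemma seq_restrict_eq_imp_le:
  assumes "seq_restrict \<xi> n = seq_restrict \<zeta> m" "\<xi> k \<noteq> \<zeta> k"
  shows "n \<le> k"
proof (rule ccontr)
  assume "\<not> n \<le> k"
  moreover have "n = m"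
    using arg_cong[OF assms(1), of length] by (simp add: seq_restrict_def)
  ultimately show False
    using assms by (auto simp: seq_restrict_def)
qed

lemma finite_branch_set_Int:
  assumes "inj (e A)" "\<xi> \<noteq> \<zeta>"
  shows "finite (branch_set e A \<xi> \<inter> branch_set e A \<zeta>)"
proof -
  obtain k where k: "\<xi> k \<noteq> \<zeta> k"
    using assms(2) by blast
  \<comment> \<open>Injectivity of \<open>e A\<close> turns a common point into a common initial
    segment. Length \<open>k\<close> is still possible, since such a segment only sees coordinates
    below \<open>k\<close>.\<close>
  have "branch_set e A \<xi> \<inter> branch_set e A \<zeta> \<subseteq> (\<lambda>n. e A (seq_restrict \<xi> n)) ` {..k}"
  proof
    fix x assume "x \<in> branch_set e A \<xi> \<inter> branch_set e A \<zeta>"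
    then obtain n m where x: "x = e A (seq_restrict \<xi> n)" "x = e A (seq_restrict \<zeta> m)"
      unfolding branch_set_def by blast
    then have "seq_restrict \<xi> n = seq_restrict \<zeta> m"
      using injD[OF assms(1)] by simp
    then have "n \<le> k"
      using k by (rule seq_restrict_eq_imp_le)
    then show "x \<in> (\<lambda>n. e A (seq_restrict \<xi> n)) ` {..k}"
      using x(1) by simp
  qed
  then show ?thesis
    by (rule finite_subset) simp
qed

lemma infinite_branch_set:
  assumes "inj (e A)"
  shows "infinite (branch_set e A \<xi>)"
proof -
  have "branch_set e A \<xi> = range (e A \<circ> seq_restrict \<xi>)"
    by (auto simp: branch_set_def)
  then show ?thesis
    using inj_compose[OF assms inj_seq_restrict] range_inj_infinite by metis
qed

lemma finite_traces_Int:
  assumes "detector_family \<A>"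
    and "\<And>A. A \<in> \<A> \<Longrightarrow> inj (e A) \<and> range (e A) \<subseteq> A"
    and "inj \<beta>" "p \<noteq> q" "S \<in> traces \<A> e \<beta> p" "T \<in> traces \<A> e \<beta> q"
  shows "finite (S \<inter> T)"
proof -
  obtain A B where AB: "A \<in> \<A>" "B \<in> \<A>" "S \<subseteq> branch_set e A (\<beta> p)" "T \<subseteq> branch_set e B (\<beta> q)"
    using assms(5,6) by (auto simp: traces_def)
  have "finite (branch_set e A (\<beta> p) \<inter> branch_set e B (\<beta> q))"
  proof (cases "A = B")
    case True
    then show ?thesis
      using assms(2)[OF AB(1)] injD[OF assms(3), of p q] assms(4)
      by (auto intro: finite_branch_set_Int)
  next
    case False
    then have "finite (A \<inter> B)"
      using assms(1) AB by (auto simp: detector_family_def)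
    moreover have "branch_set e A (\<beta> p) \<inter> branch_set e B (\<beta> q) \<subseteq> A \<inter> B"
      using assms(2)[OF AB(1)] assms(2)[OF AB(2)] by (auto simp: branch_set_def)
    ultimately show ?thesis
      by (rule finite_subset[rotated])
  qed
  then show ?thesis
    using AB by (elim finite_subset[rotated]) blast
qed

lemma compact_space_tau:
  assumes "detector_family \<A>"
    and "\<And>A. A \<in> \<A> \<Longrightarrow> inj (e A) \<and> range (e A) \<subseteq> A"
    and "inj \<beta>"
  shows "compact_space (tau \<A> e \<beta>)"
  unfolding tau_def
proof (rule compact_space_generated_by_complements)
  have "{x} \<in> closed_subbase \<A> e \<beta>" for x
    by (simp add: closed_subbase_def)
  then have "\<Inter>(closed_subbase \<A> e \<beta>) \<subseteq> {0} \<inter> {1}"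
    by (intro Int_greatest Inter_lower)
  then show "\<Inter>(closed_subbase \<A> e \<beta>) = {}"
    by simp
next
  fix \<G> assume \<G>: "\<G> \<subseteq> closed_subbase \<A> e \<beta>"
    and linked: "\<And>K L. K \<in> \<G> \<Longrightarrow> L \<in> \<G> \<Longrightarrow> infinite (K \<inter> L)"
  have cases: "K = UNIV \<or> (\<exists>p S F. K = K_set p S F \<and> S \<in> traces \<A> e \<beta> p)" if "K \<in> \<G>" for K
  proof -
    \<comment> \<open>Linkedness of \<open>K\<close> with itself excludes the singletons of the
      subbase.\<close>
    have "K \<in> closed_subbase \<A> e \<beta>" "infinite K"
      using that \<G> linked[OF that that] by auto
    then show ?thesis
      unfolding closed_subbase_def by auto
  qed
  show "\<Inter>\<G> \<noteq> {}"
  proof (cases "\<G> \<subseteq> {UNIV}")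
    case True
    then show ?thesis by auto
  next
    case False
    then obtain p S F where K: "K_set p S F \<in> \<G>" "S \<in> traces \<A> e \<beta> p"
      using cases by blast
    \<comment> \<open>All sets \<open>K_set\<close> in the family share one apex: different apexes
      \<open>p\<close> and \<open>q\<close> would leave at most these two points besides the finite
      \<open>S \<inter> T\<close>.\<close>
    have "p \<in> L" if "L \<in> \<G>" for L
    proof (cases "L = UNIV")
      case False
      then obtain q T G where L: "L = K_set q T G" "T \<in> traces \<A> e \<beta> q"
        using cases[OF \<open>L \<in> \<G>\<close>] by blast
      have "q = p"
      proof (rule ccontr)
        assume "q \<noteq> p"
        then have "finite (insert p (insert q (S \<inter> T)))"
          using finite_traces_Int[OF assms, of p q S T] K L by auto
        moreover have "K_set p S F \<inter> L \<subseteq> insert p (insert q (S \<inter> T))"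
          by (auto simp: L K_set_def)
        ultimately show False
          using linked[OF K(1) that] finite_subset by blast
      qed
      then show ?thesis
        by (simp add: L K_set_def)
    qed simp
    then show ?thesis by blast
  qed
qed

lemma closedin_tau_subbase:
  assumes "K \<in> closed_subbase \<A> e \<beta>"
  shows "closedin (tau \<A> e \<beta>) K"
proof -
  have "openin (tau \<A> e \<beta>) (UNIV - K)"
    unfolding tau_def using assms by (intro topology_generated_by_Basis) blast
  then show ?thesis
    by (simp add: closedin_def topspace_tau)
qed

lemma closedin_tau_singleton: "closedin (tau \<A> e \<beta>) {p}"
  by (rule closedin_tau_subbase) (simp add: closed_subbase_def)

lemma closedin_tau_K_set:
  assumes "S \<in> traces \<A> e \<beta> p" "F \<subseteq> S" "finite F"
  shows "closedin (tau \<A> e \<beta>) (K_set p S F)"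
  using assms by (intro closedin_tau_subbase) (auto simp: closed_subbase_def)


section \<open>Order structure of \<open>P\<close>\<close>

lemma E_set_antimono: "C \<subseteq> D \<Longrightarrow> E_set D \<subseteq> E_set C"
  by (auto simp: E_set_def)

lemma carrier_P_poset:
  "(C, \<Lambda>) \<in> carrier (P_poset \<A> e \<beta>) \<longleftrightarrow> closedin (tau \<A> e \<beta>) C \<and> C \<noteq> {} \<and> \<Lambda> \<subseteq> E_set C"
  by (simp add: P_poset_def)

lemma le_P_poset: "(C, \<Lambda>) \<sqsubseteq>\<^bsub>P_poset \<A> e \<beta>\<^esub> (D, \<Gamma>) \<longleftrightarrow> D \<subseteq> C \<and> \<Lambda> \<subseteq> \<Gamma>"
  by (simp add: P_poset_def)

lemma partial_order_P_poset: "partial_order (P_poset \<A> e \<beta>)"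
  by unfold_locales (auto simp: P_poset_def)

lemma Phi_in_P_poset: "Phi p \<in> carrier (P_poset \<A> e \<beta>)"
  by (simp add: Phi_def carrier_P_poset closedin_tau_singleton)

text \<open>Shrinking \<open>C\<close> to one of its points enlarges \<open>E_set\<close>. This
  yields maximality, and later moves membership in a Scott open set up to maximal points.\<close>

lemma le_Phi:
  assumes "(C, \<Lambda>) \<in> carrier (P_poset \<A> e \<beta>)" "p \<in> C"
  shows "(C, \<Lambda>) \<sqsubseteq>\<^bsub>P_poset \<A> e \<beta>\<^esub> Phi p"
  using assms E_set_antimono[of "{p}" C] by (auto simp: Phi_def le_P_poset carrier_P_poset)

lemma maximal_elements_P_poset: "maximal_elements (P_poset \<A> e \<beta>) = range Phi"
proof (intro equalityI subsetI)
  fix x assume x: "x \<in> maximal_elements (P_poset \<A> e \<beta>)"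
  obtain C \<Lambda> where [simp]: "x = (C, \<Lambda>)"
    by (cases x)
  have C: "(C, \<Lambda>) \<in> carrier (P_poset \<A> e \<beta>)"
    using x by (simp add: maximal_elements_def)
  then obtain p where "p \<in> C"
    by (auto simp: carrier_P_poset)
  then have "Phi p = x"
    using x le_Phi[OF C] Phi_in_P_poset by (auto simp: maximal_elements_def)
  then show "x \<in> range Phi" by blast
next
  fix x assume "x \<in> range Phi"
  then obtain p where x: "x = ({p}, E_set {p})"
    by (auto simp: Phi_def)
  have "y = x" if "y \<in> carrier (P_poset \<A> e \<beta>)" "x \<sqsubseteq>\<^bsub>P_poset \<A> e \<beta>\<^esub> y" for y
  proof (cases y)
    case (Pair C \<Lambda>)
    then have "C = {p}" "E_set {p} \<subseteq> \<Lambda>" "\<Lambda> \<subseteq> E_set C"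
      using that by (auto simp: x le_P_poset carrier_P_poset)
    then show ?thesis by (simp add: x Pair)
  qed
  then show "x \<in> maximal_elements (P_poset \<A> e \<beta>)"
    using Phi_in_P_poset[of p] by (simp add: maximal_elements_def x Phi_def)
qed

text \<open>The pair can fail to be an element of the poset only through an empty first component.
  Bounded completeness and directed completeness thus both reduce to showing that the intersection
  is nonempty.\<close>

lemma is_lub_P_poset:
  assumes sub: "X \<subseteq> carrier (P_poset \<A> e \<beta>)" and "X \<noteq> {}" and ne: "\<Inter>(fst ` X) \<noteq> {}"
  shows "is_lub (P_poset \<A> e \<beta>) (\<Inter>(fst ` X), \<Union>(snd ` X)) X"
proof (rule least_UpperI)
  have X: "closedin (tau \<A> e \<beta>) C" "\<Lambda> \<subseteq> E_set C" if "(C, \<Lambda>) \<in> X" for C \<Lambda>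
    using that sub carrier_P_poset by blast+
  have "closedin (tau \<A> e \<beta>) (\<Inter>(fst ` X))"
    using X \<open>X \<noteq> {}\<close> by (intro closedin_Inter) auto
  moreover have "\<Union>(snd ` X) \<subseteq> E_set (\<Inter>(fst ` X))"
  proof clarify
    fix C \<Lambda> Q assume CL: "(C, \<Lambda>) \<in> X" and "Q \<in> snd (C, \<Lambda>)"
    then have "Q \<in> E_set C" using X(2)[OF CL] by auto
    moreover have "\<Inter>(fst ` X) \<subseteq> C" using CL by force
    ultimately show "Q \<in> E_set (\<Inter>(fst ` X))" using E_set_antimono by blast
  qed
  ultimately show "(\<Inter>(fst ` X), \<Union>(snd ` X)) \<in> carrier (P_poset \<A> e \<beta>)"
    using ne by (simp add: carrier_P_poset)
  show "x \<sqsubseteq>\<^bsub>P_poset \<A> e \<beta>\<^esub> (\<Inter>(fst ` X), \<Union>(snd ` X))" if "x \<in> X" for x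
    using that by (cases x) (force simp: le_P_poset)
  show "(\<Inter>(fst ` X), \<Union>(snd ` X)) \<sqsubseteq>\<^bsub>P_poset \<A> e \<beta>\<^esub> y" if "y \<in> Upper (P_poset \<A> e \<beta>) X" for y
  proof (cases y)
    case (Pair D \<Gamma>)
    have "D \<subseteq> C \<and> \<Lambda> \<subseteq> \<Gamma>" if "(C, \<Lambda>) \<in> X" for C \<Lambda>
      using Upper_memD[OF \<open>y \<in> _\<close> that sub] by (simp add: Pair le_P_poset)
    then show ?thesis
      by (fastforce simp: Pair le_P_poset)
  qed
qed (rule sub)

lemma bounded_complete_P_poset: "bounded_complete (P_poset \<A> e \<beta>)"
  unfolding bounded_complete_def
proof (intro conjI allI impI partial_order_P_poset)
  fix X assume X: "X \<subseteq> carrier (P_poset \<A> e \<beta>) \<and> X \<noteq> {} \<and> Upper (P_poset \<A> e \<beta>) X \<noteq> {}"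
  then obtain D \<Gamma> where u: "(D, \<Gamma>) \<in> Upper (P_poset \<A> e \<beta>) X"
    by fastforce
  then have "(D, \<Gamma>) \<in> carrier (P_poset \<A> e \<beta>)"
    by (simp add: Upper_def)
  then have "D \<noteq> {}"
    by (simp add: carrier_P_poset)
  moreover have "D \<subseteq> C" if "(C, \<Lambda>) \<in> X" for C \<Lambda>
    using Upper_memD[OF u that] X by (simp add: le_P_poset)
  \<comment> \<open>The nonempty first component of the upper bound lies inside every
    \<open>C\<close>.\<close>
  ultimately have "\<Inter>(fst ` X) \<noteq> {}"
    by fastforce
  then show "\<exists>s. is_lub (P_poset \<A> e \<beta>) s X"
    using is_lub_P_poset[of X \<A> e \<beta>] X by blast
qed

lemma directed_in_finite_upper_bound:
  assumes "partial_order L" "directed_in L X" "finite Y" "Y \<subseteq> X"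
  shows "\<exists>z\<in>X. \<forall>y\<in>Y. y \<sqsubseteq>\<^bsub>L\<^esub> z"
  using assms(3,4)
proof (induction Y rule: finite_induct)
  case empty
  then show ?case using assms(2) by (auto simp: directed_in_def)
next
  case (insert y Y)
  interpret partial_order L by fact
  obtain z where z: "z \<in> X" "\<forall>y\<in>Y. y \<sqsubseteq>\<^bsub>L\<^esub> z" using insert by auto
  then obtain w where w: "w \<in> X" "y \<sqsubseteq>\<^bsub>L\<^esub> w" "z \<sqsubseteq>\<^bsub>L\<^esub> w"
    using assms(2) insert.prems unfolding directed_in_def by blast
  have "X \<subseteq> carrier L" using assms(2) by (simp add: directed_in_def)
  then have "v \<sqsubseteq>\<^bsub>L\<^esub> w" if "v \<in> Y" for v
    using that z w insert.prems by (intro le_trans[of v z w]) auto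
  then show ?case using w by auto
qed

text \<open>Finite intersection property: finitely many members of \<open>X\<close> have an upper
  bound in \<open>X\<close>, whose nonempty first component lies in all of theirs.\<close>

lemma directed_Inter_nonempty:
  assumes "compact_space (tau \<A> e \<beta>)" and X: "directed_in (P_poset \<A> e \<beta>) X"
  shows "\<Inter>(fst ` X) \<noteq> {}"
proof (rule compact_space_fip[THEN iffD1, OF assms(1), rule_format], intro conjI ballI allI impI)
  have sub: "X \<subseteq> carrier (P_poset \<A> e \<beta>)"
    using X by (simp add: directed_in_def)
  show "closedin (tau \<A> e \<beta>) C" if "C \<in> fst ` X" for C
    using that sub carrier_P_poset by fastforce
  fix \<F> assume "finite \<F> \<and> \<F> \<subseteq> fst ` X"
  then obtain Y where Y: "finite Y" "Y \<subseteq> X" "\<F> = fst ` Y"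
    by (meson finite_subset_image)
  obtain C \<Lambda> where z: "(C, \<Lambda>) \<in> X" "\<forall>y\<in>Y. y \<sqsubseteq>\<^bsub>P_poset \<A> e \<beta>\<^esub> (C, \<Lambda>)"
    using directed_in_finite_upper_bound[OF partial_order_P_poset X Y(1,2)] by fastforce
  have "C \<noteq> {}"
    using z(1) sub carrier_P_poset by blast
  moreover have "C \<subseteq> D" if "(D, \<Gamma>) \<in> Y" for D \<Gamma>
    using z(2) that by (auto simp: le_P_poset dest!: bspec)
  ultimately show "\<Inter>\<F> \<noteq> {}"
    unfolding Y by fastforce
qed

lemma dcpo_P_poset:
  assumes "compact_space (tau \<A> e \<beta>)"
  shows "dcpo (P_poset \<A> e \<beta>)"
  unfolding dcpo_def
proof (intro conjI allI impI partial_order_P_poset)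
  fix X assume X: "directed_in (P_poset \<A> e \<beta>) X"
  show "\<exists>s. is_lub (P_poset \<A> e \<beta>) s X"
    using is_lub_P_poset[OF _ _ directed_Inter_nonempty[OF assms X]] X
    unfolding directed_in_def by blast
qed


section \<open>The Scott topology on the maximal points\<close>

lemma scott_open_Collect_mem_snd:
  assumes "compact_space (tau \<A> e \<beta>)"
  shows "scott_open (P_poset \<A> e \<beta>) {x \<in> carrier (P_poset \<A> e \<beta>). Q \<in> snd x}"
  unfolding scott_open_def
proof (intro conjI allI impI ballI)
  fix x y assume "x \<in> {x \<in> carrier (P_poset \<A> e \<beta>). Q \<in> snd x}"
    "y \<in> carrier (P_poset \<A> e \<beta>)" "x \<sqsubseteq>\<^bsub>P_poset \<A> e \<beta>\<^esub> y"
  then show "y \<in> {x \<in> carrier (P_poset \<A> e \<beta>). Q \<in> snd x}"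
    by (cases x; cases y) (auto simp: le_P_poset)
next
  fix X s assume *: "directed_in (P_poset \<A> e \<beta>) X \<and> is_lub (P_poset \<A> e \<beta>) s X \<and>
    s \<in> {x \<in> carrier (P_poset \<A> e \<beta>). Q \<in> snd x}"
  then have X: "X \<subseteq> carrier (P_poset \<A> e \<beta>)" "X \<noteq> {}"
    by (auto simp: directed_in_def)
  \<comment> \<open>Suprema are unique, so \<open>Q\<close> lies in the union of the second
    components and hence in one of them.\<close>
  have "s = (\<Inter>(fst ` X), \<Union>(snd ` X))"
    using * is_lub_P_poset[OF X directed_Inter_nonempty[OF assms]]
      partial_order.least_unique[OF partial_order_P_poset] by blast
  then show "X \<inter> {x \<in> carrier (P_poset \<A> e \<beta>). Q \<in> snd x} \<noteq> {}"
    using * X by auto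
qed auto

lemma scott_open_directed:
  assumes "scott_open (P_poset \<A> e \<beta>) U" "directed_in (P_poset \<A> e \<beta>) X"
    and "(\<Inter>(fst ` X), \<Union>(snd ` X)) \<in> U"
  shows "X \<inter> U \<noteq> {}"
proof -
  \<comment> \<open>Here the nonempty intersection comes from \<open>U\<close> being a subset of the
    carrier.\<close>
  have "(\<Inter>(fst ` X), \<Union>(snd ` X)) \<in> carrier (P_poset \<A> e \<beta>)"
    using assms(1,3) unfolding scott_open_def by blast
  then have "\<Inter>(fst ` X) \<noteq> {}"
    by (simp add: carrier_P_poset)
  then have "is_lub (P_poset \<A> e \<beta>) (\<Inter>(fst ` X), \<Union>(snd ` X)) X"
    using assms(2) by (intro is_lub_P_poset) (simp_all add: directed_in_def)
  then show ?thesis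
    using assms unfolding scott_open_def by blast
qed

lemma countable_Phi_notin_scott_open:
  assumes \<A>: "detector_family \<A>"
    and e: "\<And>A. A \<in> \<A> \<Longrightarrow> inj (e A) \<and> range (e A) \<subseteq> A"
    and U: "scott_open (P_poset \<A> e \<beta>) U" and p: "Phi p \<in> U"
  shows "countable {q. Phi q \<notin> U}"
proof (rule ccontr)
  assume unc: "uncountable {q. Phi q \<notin> U}"
  let ?P = "P_poset \<A> e \<beta>"
  define X where "X = (\<lambda>\<Lambda>. ({p}, \<Lambda>)) ` {\<Lambda>. finite \<Lambda> \<and> \<Lambda> \<subseteq> E_set {p}}"
  have "directed_in ?P X"
    unfolding directed_in_def
  proof (intro conjI ballI)
    show "X \<subseteq> carrier ?P"
      by (auto simp: X_def carrier_P_poset closedin_tau_singleton)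
    show "X \<noteq> {}"
      by (auto simp: X_def)
    fix x y assume "x \<in> X" "y \<in> X"
    then obtain \<Lambda> \<Gamma> where "x = ({p}, \<Lambda>)" "y = ({p}, \<Gamma>)"
      "finite \<Lambda>" "finite \<Gamma>" "\<Lambda> \<subseteq> E_set {p}" "\<Gamma> \<subseteq> E_set {p}"
      by (auto simp: X_def)
    then show "\<exists>z\<in>X. x \<sqsubseteq>\<^bsub>?P\<^esub> z \<and> y \<sqsubseteq>\<^bsub>?P\<^esub> z"
      by (intro bexI[of _ "({p}, \<Lambda> \<union> \<Gamma>)"]) (auto simp: X_def le_P_poset)
  qed
  moreover have "(\<Inter>(fst ` X), \<Union>(snd ` X)) = Phi p"
  proof -
    have "Q \<in> \<Union>(snd ` X)" if "Q \<in> E_set {p}" for Q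
      using that by (auto simp: X_def image_image intro!: exI[of _ "{Q}"])
    moreover have "\<Inter>(fst ` X) = {p}"
      by (auto simp: X_def image_image)
    ultimately show ?thesis
      by (auto simp: Phi_def X_def)
  qed
  ultimately have "X \<inter> U \<noteq> {}"
    using scott_open_directed[OF U] p by metis
  then obtain \<Lambda> where \<Lambda>: "finite \<Lambda>" "\<Lambda> \<subseteq> E_set {p}" "({p}, \<Lambda>) \<in> U"
    by (auto simp: X_def)
  \<comment> \<open>This is what finiteness of \<open>\<Lambda>\<close> buys:
    \<open>E_set {p}\<close> itself has union \<open>UNIV - {p}\<close>, leaving no room for a
    detector.\<close>
  have "countable (\<Union>\<Lambda>)"
    using \<Lambda>(1,2) countable_finite[OF \<Lambda>(1)]
    by (metis (no_types, lifting) E_set_def countable_UN image_ident mem_Collect_eq subset_iff)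
  then have "uncountable ({q. Phi q \<notin> U} - \<Union>\<Lambda>)"
    using unc by (simp add: uncountable_minus_countable)
  then obtain A where A: "A \<in> \<A>" "A \<subseteq> {q. Phi q \<notin> U} - \<Union>\<Lambda>"
    using \<A> unfolding detector_family_def by meson
  define S where "S = branch_set e A (\<beta> p) - {p}"
  have S: "S \<in> traces \<A> e \<beta> p" "S \<subseteq> A" "infinite S" "p \<notin> S"
    using A(1) e[OF A(1)] infinite_branch_set[of e A]
    by (auto simp: S_def traces_def) (auto simp: branch_set_def)
  define Y where "Y = (\<lambda>F. (K_set p S F, \<Lambda>)) ` {F. finite F \<and> F \<subseteq> S}"
  have Y_carrier: "(K_set p S F, \<Lambda>) \<in> carrier ?P" if "finite F" "F \<subseteq> S" for F
  proof -
    \<comment> \<open>Members of \<open>\<Lambda>\<close> avoid \<open>p\<close> by the choice of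
      \<open>\<Lambda>\<close>, and avoid \<open>S\<close> because \<open>A\<close> misses
      \<open>\<Union>\<Lambda>\<close>.\<close>
    have "\<Lambda> \<subseteq> E_set (K_set p S F)"
      using \<Lambda>(2) S(2) A(2) by (fastforce simp: E_set_def K_set_def)
    then show ?thesis
      using closedin_tau_K_set[OF S(1) that(2,1)] by (auto simp: carrier_P_poset K_set_def)
  qed
  have "directed_in ?P Y"
    unfolding directed_in_def
  proof (intro conjI ballI)
    show "Y \<subseteq> carrier ?P"
      using Y_carrier by (auto simp: Y_def)
    show "Y \<noteq> {}"
      by (auto simp: Y_def)
    fix x y assume "x \<in> Y" "y \<in> Y"
    then obtain F G where "x = (K_set p S F, \<Lambda>)" "y = (K_set p S G, \<Lambda>)"
      "finite F" "finite G" "F \<subseteq> S" "G \<subseteq> S"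
      by (auto simp: Y_def)
    then show "\<exists>z\<in>Y. x \<sqsubseteq>\<^bsub>?P\<^esub> z \<and> y \<sqsubseteq>\<^bsub>?P\<^esub> z"
      by (intro bexI[of _ "(K_set p S (F \<union> G), \<Lambda>)"]) (auto simp: Y_def le_P_poset K_set_def)
  qed
  moreover have "(\<Inter>(fst ` Y), \<Union>(snd ` Y)) = ({p}, \<Lambda>)"
  proof -
    have "x = p" if "x \<in> \<Inter>(fst ` Y)" for x
    proof (rule ccontr)
      assume "x \<noteq> p"
      \<comment> \<open>\<open>S \<inter> {x}\<close> is an admissible finite subset of
        \<open>S\<close> whether or not \<open>x\<close> lies in \<open>S\<close>; removing it
        excludes every \<open>x\<close> other than \<open>p\<close>.\<close>
      moreover have "x \<in> K_set p S (S \<inter> {x})"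
        using that by (auto simp: Y_def image_image)
      ultimately show False
        by (auto simp: K_set_def)
    qed
    moreover have "p \<in> \<Inter>(fst ` Y)"
      by (auto simp: Y_def K_set_def)
    ultimately show ?thesis
      by (auto simp: Y_def)
  qed
  ultimately have "Y \<inter> U \<noteq> {}"
    using scott_open_directed[OF U] \<Lambda>(3) by metis
  then obtain F where F: "finite F" "F \<subseteq> S" "(K_set p S F, \<Lambda>) \<in> U"
    by (auto simp: Y_def)
  obtain q where q: "q \<in> S" "q \<notin> F"
    using S(3) F(1) by (meson finite_subset subsetI)
  have "(K_set p S F, \<Lambda>) \<sqsubseteq>\<^bsub>?P\<^esub> Phi q"
    using le_Phi[OF Y_carrier[OF F(1,2)]] q by (simp add: K_set_def)
  then have "Phi q \<in> U"
    using U F(3) Phi_in_P_poset unfolding scott_open_def by blast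
  then show False
    using q(1) S(2) A(2) by blast
qed

theorem corollary6p3:
  fixes \<A> :: "real set set"
    and e :: "real set \<Rightarrow> bool list \<Rightarrow> real"
    and \<beta> :: "real \<Rightarrow> nat \<Rightarrow> bool"
  assumes "detector_family \<A>"
    and "\<And>A. A \<in> \<A> \<Longrightarrow> inj (e A) \<and> range (e A) \<subseteq> A"
    and "bij \<beta>"
  shows "homeomorphic_map cocountable_topology
           (subtopology (scott_topology (P_poset \<A> e \<beta>)) (maximal_elements (P_poset \<A> e \<beta>))) Phi
       \<and> dcpo (P_poset \<A> e \<beta>)
       \<and> bounded_complete (P_poset \<A> e \<beta>)"
proof (intro conjI)
  let ?P = "P_poset \<A> e \<beta>"
  let ?M = "subtopology (scott_topology ?P) (maximal_elements ?P)"
  have compact: "compact_space (tau \<A> e \<beta>)"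
    using compact_space_tau[OF assms(1,2)] bij_is_inj[OF assms(3)] by blast
  show "dcpo ?P"
    by (rule dcpo_P_poset[OF compact])
  show "bounded_complete ?P"
    by (rule bounded_complete_P_poset)
  have inj: "inj Phi"
    by (auto simp: inj_def Phi_def)
  have openM: "openin ?M V \<longleftrightarrow> (\<exists>U. scott_open ?P U \<and> V = U \<inter> range Phi)" for V
    by (auto simp: openin_subtopology openin_scott_topology maximal_elements_P_poset)
  have topcc: "topspace cocountable_topology = UNIV"
    by (metis UNIV_I openin_cocountable_topology openin_subset Compl_UNIV_eq countable_empty top.extremum_uniqueI)
  have "scott_open ?P (carrier ?P)"
    by (auto simp: scott_open_def directed_in_def)
  then have "carrier ?P \<subseteq> topspace (scott_topology ?P)"
    by (metis openin_scott_topology openin_subset)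
  then have topM: "topspace ?M = range Phi"
    using Phi_in_P_poset by (fastforce simp: maximal_elements_P_poset)
  show "homeomorphic_map cocountable_topology ?M Phi"
  proof (rule bijective_open_imp_homeomorphic_map)
    show "continuous_map cocountable_topology ?M Phi"
      unfolding continuous_map
    proof (intro conjI allI impI)
      show "Phi ` topspace cocountable_topology \<subseteq> topspace ?M"
        using topM by blast
      fix V assume "openin ?M V"
      then obtain U where U: "scott_open ?P U" "V = U \<inter> range Phi"
        using openM by blast
      \<comment> \<open>Either no \<open>Phi p\<close> lies in \<open>U\<close> and the preimage is
        empty, or one does and the preimage is cocountable.\<close>
      have "countable {q. Phi q \<notin> U}" if "Phi p \<in> U" for p
        using countable_Phi_notin_scott_open[OF assms(1,2) U(1) that] by blast
      moreover have "- {x. Phi x \<in> U} = {q. Phi q \<notin> U}"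
        by blast
      ultimately show "openin cocountable_topology {x \<in> topspace cocountable_topology. Phi x \<in> V}"
        by (auto simp: openin_cocountable_topology topcc U(2))
    qed
    show "open_map cocountable_topology ?M Phi"
      unfolding open_map_def
    proof (intro allI impI)
      fix V assume V: "openin cocountable_topology V"
      show "openin ?M (Phi ` V)"
      \<comment> \<open>The empty set is separate: its complement is uncountable and belongs to no
        \<open>E_set\<close>.\<close>
      proof (cases "V = {}")
        case False
        then have "countable (- V)"
          using V by (simp add: openin_cocountable_topology)
        then have "- V \<in> snd (Phi p) \<longleftrightarrow> p \<in> V" for p
          by (auto simp: Phi_def E_set_def)
        then have "Phi ` V = {x \<in> carrier ?P. - V \<in> snd x} \<inter> range Phi"
          using Phi_in_P_poset by blast
        then show ?thesis
          using openM scott_open_Collect_mem_snd[OF compact] by blast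
      qed simp
    qed
    show "Phi ` topspace cocountable_topology = topspace ?M"
      using topM topcc by metis
    show "inj_on Phi (topspace cocountable_topology)"
      by (simp add: topcc inj)
  qed
qed

end
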